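(* Let $s\ge 1$ be an integer, let $\gamma,\alpha\in(0,1)$, and consider testing the null hypotheses $H_i: P\in\omega_i$, $i=1,\ldots,s$, based on $p$-values $\hat p_1,\ldots,\hat p_s$ satisfying $$P\{\hat p_i\le u\}\le u\quad\text{for every } u\in(0,1)\text{ and every } P\in\omega_i ,\qquad i=1,\ldots,s,$$ with no assumption on the joint distribution of the $p$-values. Let $\delta_1\le\cdots\le\delta_s$ be any nondecreasing sequence of constants such that $0\le\delta_i\le 1$, and consider the stepdown procedure with constants $\delta_i''=\alpha\delta_i/D(\gamma,s)$, $i=1,\ldots,s$, where $D(\gamma,s)$ is the constant defined in the context from the sequence $(\delta_i)$. Then $$P\{FDP>\gamma\}\le\alpha\qquad\text{for every } P\in\Omega .$$
   Context: Setup. Data $X$ have distribution $P$ belonging to a model $\Omega$ (a family of probability distributions). Each null hypothesis $H_i$ is identified with a subset $\omega_i\subset\Omega$. For $P\in\Omega$, $I=I(P)=\{i: P\in\omega_i\}$ is the set of indices of true null hypotheses, and $|I|$ is its cardinality. The $p$-values $\hat p_1,\ldots,\hat p_s$ are statistics (functions of $X$). Stepdown procedure with constants $c_1\le c_2\le\cdots\le c_s$. Let $\hat p_{(1)}\le\cdots\le\hat p_{(s)}$ be the ordered $p$-values with corresponding hypotheses $H_{(1)},\ldots,H_{(s)}$. If $\hat p_{(1)}>c_1$, reject no hypotheses. Otherwise reject $H_{(1)},\ldots,H_{(r)}$, where $r$ is the largest index such that $\hat p_{(1)}\le c_1,\ldots,\hat p_{(r)}\le c_r$. False discovery proportion. $FDP$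 is the number of rejected hypotheses $H_i$ with $i\in I(P)$ divided by the total number of rejected hypotheses, and $FDP=0$ if there are no rejections. The constant $D(\gamma,s)$ associated with $(\delta_i)$. For an integer $1\le |I|\le s$ (here $|I|$ is treated as a variable integer, ranging over the possible numbers of true hypotheses), put $\beta_0=0$, $$\beta_m=\delta_{k(s,\gamma,m,|I|)},\quad m=1,\ldots,\lfloor\gamma s\rfloor+1,\qquad k(s,\gamma,m,|I|)=\min\{s,\ s+m-|I|,\ \lceil m/\gamma\rceil-1\},$$ $$N=N(\gamma,s,|I|)=\min\Big\{\lfloor\gamma s\rfloor+1,\ |I|,\ \Big\lfloor\gamma\Big(\frac{s-|I|}{1-\gamma}+1\Big)\Big\rfloor+1\Big\},$$ $$S(\gamma,s,|I|)=|I|\sum_{i=1}^{N}\frac{\beta_i-\beta_{i-1}}{i},\qquad D(\gamma,s)=\max_{|I|}S(\gamma,s,|I|).$$ Here $\lfloor x\rfloor$ is the greatest integer $\le x$ and $\lceil x\rceil$ the least integer $\ge x$. *)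

theory Defs
  imports "HOL-Probability.Probability"
begin

text \<open>Hypotheses are indexed by \<open>{1..s}\<close>, and \<open>p i\<close> is the p-value of hypothesis \<open>i\<close>.\<close>

text \<open>The indices \<open>(1), \<dots>, (s)\<close>, position \<open>j\<close> being list entry \<open>j - 1\<close>. The sort is stable,
  so ties are broken by index; for nondecreasing critical constants the set rejected by the
  stepdown procedure does not depend on how ties are broken.\<close>
definition ordered_hyps :: "nat \<Rightarrow> (nat \<Rightarrow> real) \<Rightarrow> nat list" where
  "ordered_hyps s p = sort_key p [1..<Suc s]"

definition ordered_pval :: "nat \<Rightarrow> (nat \<Rightarrow> real) \<Rightarrow> nat \<Rightarrow> real" where
  "ordered_pval s p j = p (ordered_hyps s p ! (j - 1))"

text \<open>The value \<open>0\<close> always belongs to the set below, and is its maximum exactly when the smallest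
  p-value exceeds \<open>c 1\<close>.\<close>
definition stepdown_count :: "nat \<Rightarrow> (nat \<Rightarrow> real) \<Rightarrow> (nat \<Rightarrow> real) \<Rightarrow> nat" where
  "stepdown_count s c p = Max {r \<in> {0..s}. \<forall>j\<in>{1..r}. ordered_pval s p j \<le> c j}"

definition stepdown_rejected :: "nat \<Rightarrow> (nat \<Rightarrow> real) \<Rightarrow> (nat \<Rightarrow> real) \<Rightarrow> nat set" where
  "stepdown_rejected s c p = set (take (stepdown_count s c p) (ordered_hyps s p))"

definition true_hyps :: "nat \<Rightarrow> (nat \<Rightarrow> 'a measure set) \<Rightarrow> 'a measure \<Rightarrow> nat set" where
  "true_hyps s \<omega> P = {i \<in> {1..s}. P \<in> \<omega> i}"

definition fdp :: "nat set \<Rightarrow> nat set \<Rightarrow> real" where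
  "fdp R I = (if R = {} then 0 else real (card (R \<inter> I)) / real (card R))"

text \<open>In the remaining definitions \<open>t\<close> is the number \<open>|I|\<close> of true hypotheses, with
  \<open>1 \<le> t \<le> s\<close>. For \<open>0 < \<gamma> < 1\<close> and \<open>m \<ge> 1\<close> the integers converted by \<open>nat\<close> are positive.\<close>

definition k_index :: "nat \<Rightarrow> real \<Rightarrow> nat \<Rightarrow> nat \<Rightarrow> nat" where
  "k_index s \<gamma> m t =
     nat (Min {int s, int s + int m - int t, \<lceil>real m / \<gamma>\<rceil> - 1})"

definition beta :: "(nat \<Rightarrow> real) \<Rightarrow> real \<Rightarrow> nat \<Rightarrow> nat \<Rightarrow> nat \<Rightarrow> real" where
  "beta \<delta> \<gamma> s t m = (if m = 0 then 0 else \<delta> (k_index s \<gamma> m t))"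

definition N_bound :: "real \<Rightarrow> nat \<Rightarrow> nat \<Rightarrow> nat" where
  "N_bound \<gamma> s t =
     nat (Min {\<lfloor>\<gamma> * real s\<rfloor> + 1, int t,
               \<lfloor>\<gamma> * ((real s - real t) / (1 - \<gamma>) + 1)\<rfloor> + 1})"

definition S_sum :: "(nat \<Rightarrow> real) \<Rightarrow> real \<Rightarrow> nat \<Rightarrow> nat \<Rightarrow> real" where
  "S_sum \<delta> \<gamma> s t =
     real t * (\<Sum>i = 1..N_bound \<gamma> s t. (beta \<delta> \<gamma> s t i - beta \<delta> \<gamma> s t (i - 1)) / real i)"

definition D_const :: "(nat \<Rightarrow> real) \<Rightarrow> real \<Rightarrow> nat \<Rightarrow> real" where
  "D_const \<delta> \<gamma> s = Max (S_sum \<delta> \<gamma> s ` {1..s})"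

text \<open>\<open>D_const\<close> may vanish (for instance if all \<open>\<delta> i\<close> are \<open>0\<close>), and then the constants
  \<open>\<alpha> * \<delta> i / D_const \<delta> \<gamma> s\<close> are \<open>0\<close> by the convention \<open>x / 0 = 0\<close>.\<close>
definition adjusted_const :: "real \<Rightarrow> (nat \<Rightarrow> real) \<Rightarrow> real \<Rightarrow> nat \<Rightarrow> nat \<Rightarrow> real" where
  "adjusted_const \<alpha> \<delta> \<gamma> s i = \<alpha> * \<delta> i / D_const \<delta> \<gamma> s"

end

theory Submission imports Defs begin

text \<open>Let \<open>j\<close> be the first position in the ordering at which the proportion of true hypotheses among
  the first \<open>j\<close> exceeds \<open>\<gamma>\<close>, and let \<open>m\<close> be the number of true hypotheses there. Minimality
  of \<open>j\<close> gives \<open>m \<le> N\<close> and \<open>j \<le> k(s, \<gamma>, m, |I|)\<close>, so \<open>FDP > \<gamma>\<close> forces at least \<open>m\<close> true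
  p-values below \<open>\<beta>\<^sub>m\<close> for some \<open>m \<le> N\<close>. The probability of that union is bounded by Markov's
  inequality applied to the sum of the weights \<open>1/l\<close> over all true p-values in
  \<open>(\<beta>\<^bsub>l-1\<^esub>, \<beta>\<^sub>l]\<close>, with a summation by parts to compare their distribution functions
  with the uniform one.\<close>

section \<open>Sums of increments weighted by \<open>1/l\<close>\<close>

text \<open>Abel summation: on the right every coefficient of \<open>f\<close> is nonnegative, so
  two such sums can be compared through the values of the functions instead of their
  increments.\<close>

lemma sum_diff_divide_by_parts:
  fixes f :: "nat \<Rightarrow> real"
  assumes "f 0 = 0"
  shows "(\<Sum>l = 1..n. (f l - f (l - 1)) / real l)
       = (\<Sum>l = 1..n. f l / (real l * real (l + 1))) + f n / real (n + 1)"
proof (induction n)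
  case 0
  show ?case using assms by simp
next
  case (Suc n)
  have "f n / real (n + 1) + (f (Suc n) - f n) / real (Suc n)
      = f (Suc n) / (real (Suc n) * real (Suc n + 1)) + f (Suc n) / real (Suc n + 1)"
    by (simp add: divide_simps) (simp add: algebra_simps)
  with Suc show ?case by simp
qed

lemma sum_diff_divide_mono:
  fixes f g :: "nat \<Rightarrow> real"
  assumes "f 0 = 0" "g 0 = 0" and le: "\<And>l. l \<le> n \<Longrightarrow> f l \<le> g l"
  shows "(\<Sum>l = 1..n. (f l - f (l - 1)) / real l) \<le> (\<Sum>l = 1..n. (g l - g (l - 1)) / real l)"
  unfolding sum_diff_divide_by_parts[of f, OF assms(1)] sum_diff_divide_by_parts[of g, OF assms(2)]
  by (intro add_mono sum_mono divide_right_mono le) auto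

text \<open>Up to \<open>m\<close> the weights \<open>1/l\<close> are at least \<open>1/m\<close>,
  with which the increments telescope to \<open>f m / m\<close>; the terms beyond \<open>m\<close>
  are nonnegative.\<close>

lemma sum_diff_divide_ge:
  fixes f :: "nat \<Rightarrow> real"
  assumes "f 0 = 0" and mono: "mono_on {0..n} f" and m: "1 \<le> m" "m \<le> n"
  shows "f m / real m \<le> (\<Sum>l = 1..n. (f l - f (l - 1)) / real l)"
proof -
  have step: "0 \<le> f l - f (l - 1)" if "l \<in> {1..n}" for l
    using mono that by (auto intro!: mono_onD[OF mono])
  have "f m = (\<Sum>l = 1..m. f l - f (l - 1))"
    using assms(1) by (induction m) auto
  then have "f m / real m = (\<Sum>l = 1..m. (f l - f (l - 1)) / real m)"
    by (simp add: sum_divide_distrib)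
  also have "\<dots> \<le> (\<Sum>l = 1..m. (f l - f (l - 1)) / real l)"
    using step m by (intro sum_mono divide_left_mono) auto
  also have "\<dots> \<le> (\<Sum>l = 1..n. (f l - f (l - 1)) / real l)"
    using step m by (intro sum_mono2) auto
  finally show ?thesis .
qed

section \<open>A bound for unions of order statistic events under arbitrary dependence\<close>

text \<open>By linearity of expectation only the marginal distributions of the \<open>q i\<close>
  enter, so nothing is asked of their dependence.\<close>

lemma (in prob_space) prob_order_statistic_union_le:
  fixes q :: "'i \<Rightarrow> 'a \<Rightarrow> real" and b :: "nat \<Rightarrow> real"
  assumes fin: "finite I"
    and meas: "\<And>i. i \<in> I \<Longrightarrow> random_variable borel (q i)"
    and cdf: "\<And>i u. i \<in> I \<Longrightarrow> 0 \<le> u \<Longrightarrow> prob {x \<in> space M. q i x \<le> u} \<le> u"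
    and b0: "b 0 = 0" and mono: "mono_on {0..n} b"
  defines "E \<equiv> {x \<in> space M. \<exists>m\<in>{1..n}. m \<le> card {i \<in> I. q i x \<le> b m}}"
  shows "E \<in> events"
    and "prob E \<le> real (card I) * (\<Sum>l = 1..n. (b l - b (l - 1)) / real l)"
proof -
  \<comment> \<open>For \<open>l = 0\<close> the set is empty instead of
    \<open>q i x \<le> b 0\<close>, so the indicator starts at 0 at every outcome, even where
    \<open>q i x \<le> 0\<close>.\<close>
  define A where "A i l = (if l = 0 then {} else {x \<in> space M. q i x \<le> b l})" for i l
  define X where "X x = (\<Sum>i\<in>I. \<Sum>l = 1..n. (indicator (A i l) x - indicator (A i (l - 1)) x) / real l)"
    for x :: 'a
  have A[measurable]: "A i l \<in> events" if "i \<in> I" for i l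
    using meas[OF that] unfolding A_def by simp
  have card_eq: "real (card {i \<in> I. q i x \<le> b m}) = (\<Sum>i\<in>I. indicator (A i m) x)"
    if "x \<in> space M" "m \<noteq> 0" for x m
    using fin that by (simp add: A_def indicator_def sum.If_cases Int_def)
  have "{x \<in> space M. m \<le> card {i \<in> I. q i x \<le> b m}} \<in> events" if "m \<noteq> 0" for m
  proof -
    \<comment> \<open>Writing the count as a sum of indicators makes the event visibly
      measurable.\<close>
    have "{x \<in> space M. m \<le> card {i \<in> I. q i x \<le> b m}}
        = {x \<in> space M. real m \<le> (\<Sum>i\<in>I. indicator (A i m) x)}"
      using card_eq[OF _ that] by (smt (verit) Collect_cong of_nat_le_iff)
    also have "\<dots> \<in> events"
      by measurable
    finally show ?thesis .
  qed
  moreover have "E = (\<Union>m\<in>{1..n}. {x \<in> space M. m \<le> card {i \<in> I. q i x \<le> b m}})"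
    unfolding E_def by auto
  ultimately show E: "E \<in> events"
    by auto
  have mono_ind: "mono_on {0..n} (\<lambda>l. indicator (A i l) x :: real)" for i x
    using mono by (auto simp: A_def indicator_def mono_on_def intro: order_trans)
  have X_ge: "(\<Sum>i\<in>I. indicator (A i m) x) / real m \<le> X x" if "m \<in> {1..n}" for m x
    unfolding X_def sum_divide_distrib
    using that by (intro sum_mono sum_diff_divide_ge mono_ind) (auto simp: A_def)
  \<comment> \<open>Pointwise form of Markov's inequality at level 1: \<open>X\<close> is at least 1
    on \<open>E\<close> and nonnegative elsewhere.\<close>
  have "indicator E x \<le> X x" if "x \<in> space M" for x
  proof (cases "x \<in> E")
    case True
    then obtain m where m: "m \<in> {1..n}" "m \<le> card {i \<in> I. q i x \<le> b m}"
      unfolding E_def by auto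
    have "1 \<le> (\<Sum>i\<in>I. indicator (A i m) x) / real m"
      using m card_eq[OF that, of m] by (simp add: le_divide_eq)
    with X_ge[OF m(1), of x] True show ?thesis by simp
  next
    case False
    have "0 \<le> X x"
      unfolding X_def
      by (intro sum_nonneg divide_nonneg_nonneg) (auto intro!: mono_onD[OF mono_ind])
    with False show ?thesis by simp
  qed
  moreover have int: "integrable M (\<lambda>x. (indicator (A i l) x - indicator (A i (l - 1)) x) / real l :: real)"
    if "i \<in> I" for i l
    using A[OF that] by (intro integrable_divide_zero Bochner_Integration.integrable_diff)
      (auto simp: emeasure_eq_measure)
  moreover from int have "integrable M X"
    unfolding X_def by (intro Bochner_Integration.integrable_sum)
  ultimately have "expectation (indicator E) \<le> expectation X"
    using E by (intro integral_mono) (auto simp: emeasure_eq_measure)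
  then have "prob E \<le> expectation X"
    using E by simp
  also have "expectation X = (\<Sum>i\<in>I. \<Sum>l = 1..n. (prob (A i l) - prob (A i (l - 1))) / real l)"
  proof -
    have "expectation (\<lambda>x. (indicator (A i l) x - indicator (A i (l - 1)) x) / real l)
        = (prob (A i l) - prob (A i (l - 1))) / real l" if "i \<in> I" for i l
      using A[OF that] by (simp add: Bochner_Integration.integral_diff emeasure_eq_measure)
    then show ?thesis
      using int unfolding X_def by (simp add: Bochner_Integration.integral_sum del: integral_divide_zero)
  qed
  also have "\<dots> \<le> (\<Sum>i\<in>I. \<Sum>l = 1..n. (b l - b (l - 1)) / real l)"
  \<comment> \<open>The increments need not compare term by term; only
    \<open>prob (A i l) \<le> b l\<close> is available, and summation by parts needs no
    more.\<close>
  proof (rule sum_mono, rule sum_diff_divide_mono)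
    fix i l assume "i \<in> I" "l \<le> n"
    moreover from \<open>l \<le> n\<close> have "0 \<le> b l"
      using mono_onD[OF mono, of 0 l] b0 by simp
    ultimately show "prob (A i l) \<le> b l"
      using cdf by (simp add: A_def b0)
  qed (auto simp: A_def b0)
  finally show "prob E \<le> real (card I) * (\<Sum>l = 1..n. (b l - b (l - 1)) / real l)"
    by simp
qed

section \<open>The indices \<open>k\<close> and the constants \<open>beta\<close>\<close>

text \<open>The ceiling minus 1 is the largest integer strictly below \<open>m / \<gamma>\<close>,
  whence the strict third condition. Monotonicity in \<open>m\<close> and the range of the index are
  read off this form.\<close>

lemma k_index_le_iff:
  assumes "t \<le> s" "1 \<le> m" "0 < \<gamma>" "\<gamma> < 1"
  shows "j \<le> k_index s \<gamma> m t \<longleftrightarrow> j \<le> s \<and> j + t \<le> s + m \<and> \<gamma> * real j < real m"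
proof -
  have "int j \<le> \<lceil>real m / \<gamma>\<rceil> - 1 \<longleftrightarrow> int j < \<lceil>real m / \<gamma>\<rceil>"
    by linarith
  also have "\<dots> \<longleftrightarrow> \<gamma> * real j < real m"
    using assms(3) by (simp add: less_ceiling_iff pos_less_divide_eq mult.commute)
  finally have ceil: "int j \<le> \<lceil>real m / \<gamma>\<rceil> - 1 \<longleftrightarrow> \<gamma> * real j < real m" .
  \<comment> \<open>This makes the third entry of the minimum positive, so \<open>nat\<close>
    truncates nothing.\<close>
  have "1 < real m / \<gamma>"
    using assms by (simp add: less_divide_eq)
  then have "0 \<le> Min {int s, int s + int m - int t, \<lceil>real m / \<gamma>\<rceil> - 1}"
    using assms by simp
  then have "j \<le> k_index s \<gamma> m t
      \<longleftrightarrow> int j \<le> Min {int s, int s + int m - int t, \<lceil>real m / \<gamma>\<rceil> - 1}"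
    unfolding k_index_def by linarith
  also have "\<dots> \<longleftrightarrow> j \<le> s \<and> j + t \<le> s + m \<and> \<gamma> * real j < real m"
    using ceil by auto
  finally show ?thesis .
qed

lemma k_index_mono:
  assumes "t \<le> s" "1 \<le> m" "m \<le> m'" "0 < \<gamma>" "\<gamma> < 1"
  shows "k_index s \<gamma> m t \<le> k_index s \<gamma> m' t"
  using assms k_index_le_iff[of t s m \<gamma> "k_index s \<gamma> m t"]
  by (subst k_index_le_iff) auto

lemma k_index_in_range:
  assumes "t \<le> s" "1 \<le> s" "1 \<le> m" "0 < \<gamma>" "\<gamma> < 1"
  shows "k_index s \<gamma> m t \<in> {1..s}"
  using assms k_index_le_iff[of t s m \<gamma> "k_index s \<gamma> m t"] k_index_le_iff[of t s m \<gamma> 1]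
  by auto

lemma mono_on_beta:
  assumes "t \<le> s" "1 \<le> s" "0 < \<gamma>" "\<gamma> < 1"
    and "mono_on {1..s} c" "\<And>i. i \<in> {1..s} \<Longrightarrow> 0 \<le> c i"
  shows "mono_on A (beta c \<gamma> s t)"
proof (rule mono_onI)
  fix l m :: nat assume "l \<le> m"
  have range: "k_index s \<gamma> m t \<in> {1..s}" if "1 \<le> m" for m
    using k_index_in_range assms(1-4) that by blast
  show "beta c \<gamma> s t l \<le> beta c \<gamma> s t m"
  proof (cases "l = 0")
    case True
    then show ?thesis
      using assms(6)[OF range, of m] by (simp add: beta_def)
  next
    case False
    then show ?thesis
      using \<open>l \<le> m\<close> mono_onD[OF assms(5) range range k_index_mono] assms(1-4)
      by (simp add: beta_def)
  qed
qed

lemma S_sum_nonneg: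
  assumes "t \<le> s" "1 \<le> s" "0 < \<gamma>" "\<gamma> < 1"
    and "mono_on {1..s} c" "\<And>i. i \<in> {1..s} \<Longrightarrow> 0 \<le> c i"
  shows "0 \<le> S_sum c \<gamma> s t"
  unfolding S_sum_def
  using mono_onD[OF mono_on_beta[OF assms, of UNIV]]
  by (intro mult_nonneg_nonneg sum_nonneg divide_nonneg_nonneg) auto

lemma S_sum_cmult: "S_sum (\<lambda>i. a * c i) \<gamma> s t = a * S_sum c \<gamma> s t"
proof -
  have "beta (\<lambda>i. a * c i) \<gamma> s t m = a * beta c \<gamma> s t m" for m
    by (simp add: beta_def)
  then show ?thesis
    by (simp add: S_sum_def sum_distrib_left algebra_simps diff_divide_distrib)
qed

section \<open>Deterministic analysis of the stepdown procedure\<close>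

lemma fdp_gt_imp_order_statistic_le:
  assumes \<gamma>: "0 < \<gamma>" "\<gamma> < 1"
    and c: "mono_on {1..s} c" and I: "I \<subseteq> {1..s}"
    and fdp: "\<gamma> < fdp (stepdown_rejected s c p) I"
  shows "\<exists>m\<in>{1..N_bound \<gamma> s (card I)}. m \<le> card {i \<in> I. p i \<le> beta c \<gamma> s (card I) m}"
proof -
  define xs where "xs = ordered_hyps s p"
  define r where "r = stepdown_count s c p"
  define v where "v j = card (set (take j xs) \<inter> I)" for j
  define t where "t = card I"
  have xs: "distinct xs" "set xs = {1..s}" "length xs = s" "sorted (map p xs)"
    unfolding xs_def ordered_hyps_def by auto
  have card_take: "card (set (take j xs)) = j" if "j \<le> s" for j
    using xs that by (simp add: distinct_card)
  have finI: "finite I" using I finite_subset by blast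
  have t: "t \<le> s" using card_mono[OF _ I] by (simp add: t_def)
  have "r \<in> {r \<in> {0..s}. \<forall>j\<in>{1..r}. ordered_pval s p j \<le> c j}"
    unfolding r_def stepdown_count_def by (rule Max_in) auto
  then have r: "r \<le> s" "\<And>j. j \<in> {1..r} \<Longrightarrow> p (xs ! (j - 1)) \<le> c j"
    by (auto simp: ordered_pval_def xs_def)
  have R: "stepdown_rejected s c p = set (take r xs)"
    by (simp add: stepdown_rejected_def r_def xs_def)
  have "r \<noteq> 0"
    using fdp \<gamma> by (intro notI) (simp add: R fdp_def)
  then have "\<gamma> * real r < real (v r)"
    using fdp \<gamma> card_take[OF r(1)] by (auto simp: R fdp_def v_def less_divide_eq split: if_splits)
  \<comment> \<open>First position at which the proportion exceeds \<gamma>; one exists because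
    \<open>r\<close>, the full rejected list, is such a position.\<close>
  then obtain j where j: "\<gamma> * real j < real (v j)" "j \<le> r"
    and min: "\<And>i. i < j \<Longrightarrow> real (v i) \<le> \<gamma> * real i"
    using ex_least_nat_le[of "\<lambda>j. \<gamma> * real j < real (v j)" r] by (auto simp: not_less)
  define m where "m = v j"
  have "j \<noteq> 0"
    using j(1) by (auto simp: v_def intro!: gr0I)
  then obtain i where i: "j = Suc i" by (cases j) auto
  \<comment> \<open>One more position adds at most one true hypothesis, and \<open>i = j - 1\<close>
    has not crossed yet; together they give \<open>m - 1 \<le> \<gamma> * i\<close>.\<close>
  have "m \<le> Suc (v i)"
  proof -
    have "i < length xs" using i j(2) r(1) xs(3) by simp
    then have "set (take j xs) \<inter> I \<subseteq> insert (xs ! i) (set (take i xs) \<inter> I)"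
      by (auto simp: i take_Suc_conv_app_nth)
    then have "m \<le> card (insert (xs ! i) (set (take i xs) \<inter> I))"
      unfolding m_def v_def by (intro card_mono) auto
    also have "\<dots> \<le> Suc (v i)"
      unfolding v_def by (rule card_insert_le_m1) auto
    finally show ?thesis .
  qed
  then have m_le: "real m - 1 \<le> \<gamma> * real i"
    using min[of i] i by simp
  have m1: "1 \<le> m"
    using j(1) \<gamma> mult_nonneg_nonneg[of \<gamma> "real j"] unfolding m_def by linarith
  have mt: "m \<le> t"
    unfolding m_def v_def t_def using finI by (intro card_mono) auto
  \<comment> \<open>Among the first \<open>j\<close> hypotheses \<open>j - m\<close> are false, and
    only \<open>s - t\<close> false ones exist.\<close>
  have jt: "j + t \<le> s + m"
  proof -
    have "card (set (take j xs) - I) \<le> card ({1..s} - I)"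
      using xs(2) by (intro card_mono) (auto dest: in_set_takeD)
    moreover have "card (set (take j xs) - I) = j - m"
      using card_take[of j] j(2) r(1) by (simp add: card_Diff_subset_Int m_def v_def)
    moreover have "card ({1..s} - I) = s - t"
      using I finI by (simp add: card_Diff_subset t_def)
    ultimately show ?thesis using t by linarith
  qed
  have "m \<le> N_bound \<gamma> s t"
  proof -
    have "real i \<le> real s" using i j(2) r(1) by simp
    then have "real m - 1 \<le> \<gamma> * real s"
      using m_le mult_left_mono[of "real i" "real s" \<gamma>] \<gamma> by linarith
    then have 1: "int m \<le> \<lfloor>\<gamma> * real s\<rfloor> + 1"
      by linarith
    \<comment> \<open>For the third bound in \<open>N_bound\<close>, inserting
      \<open>m - 1 \<le> \<gamma> * i\<close> here bounds \<open>i\<close>, and the same inequality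
      then bounds \<open>m\<close>.\<close>
    have "real i + real t \<le> real s + (real m - 1)"
      using jt i by linarith
    then have "real i * (1 - \<gamma>) \<le> real s - real t"
      using m_le by (simp add: algebra_simps)
    then have "real i \<le> (real s - real t) / (1 - \<gamma>)"
      using \<gamma> by (simp add: le_divide_eq)
    then have "\<gamma> * real i \<le> \<gamma> * ((real s - real t) / (1 - \<gamma>) + 1)"
      using \<gamma> by (intro mult_left_mono) auto
    then have 2: "int m \<le> \<lfloor>\<gamma> * ((real s - real t) / (1 - \<gamma>) + 1)\<rfloor> + 1"
      using m_le by linarith
    from 1 2 mt have "int m \<le> Min {\<lfloor>\<gamma> * real s\<rfloor> + 1, int t,
               \<lfloor>\<gamma> * ((real s - real t) / (1 - \<gamma>) + 1)\<rfloor> + 1}"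
      by simp
    then show ?thesis
      unfolding N_bound_def by linarith
  qed
  moreover have "m \<le> card {a \<in> I. p a \<le> beta c \<gamma> s t m}"
  proof -
    \<comment> \<open>The index is the largest position allowed by the three constraints found for
      \<open>j\<close>; monotonicity of \<open>c\<close> thus replaces \<open>c j\<close> by a
      constant that depends on \<open>j\<close> only through \<open>m\<close>.\<close>
    have "j \<le> k_index s \<gamma> m t"
      using j r(1) jt t m1 \<gamma> by (simp add: k_index_le_iff m_def)
    moreover have "k_index s \<gamma> m t \<in> {1..s}"
      using t m1 \<gamma> j r(1) \<open>j \<noteq> 0\<close> by (intro k_index_in_range) auto
    ultimately have cj: "c j \<le> beta c \<gamma> s t m"
      using m1 \<open>j \<noteq> 0\<close> j(2) r(1) by (auto simp: beta_def intro!: mono_onD[OF c])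
    \<comment> \<open>By sortedness the first \<open>j\<close> p-values are at most the one at
      position \<open>j\<close> (list entry \<open>i\<close>), which is at most \<open>c j\<close>
      because \<open>j \<le> r\<close>.\<close>
    have "p a \<le> beta c \<gamma> s t m" if a: "a \<in> set (take j xs)" for a
    proof -
      obtain l where l: "l < j" "a = xs ! l"
        using a j(2) r(1) xs(3) by (auto simp: in_set_conv_nth)
      have "p (xs ! l) \<le> p (xs ! i)"
        using sorted_nth_mono[OF xs(4), of l i] l i j(2) r(1) xs(3) by simp
      also have "\<dots> \<le> c j"
        using r(2)[of j] i j(2) by simp
      finally show ?thesis using cj l by simp
    qed
    then have "set (take j xs) \<inter> I \<subseteq> {a \<in> I. p a \<le> beta c \<gamma> s t m}"
      by blast
    then have "v j \<le> card {a \<in> I. p a \<le> beta c \<gamma> s t m}"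
      unfolding v_def using finI by (intro card_mono) auto
    then show ?thesis
      by (simp only: m_def[symmetric])
  qed
  ultimately show ?thesis
    using m1 unfolding t_def by (intro bexI[of _ m]) auto
qed

section \<open>Control of the false discovery proportion\<close>

theorem theorem3p5:
  fixes s :: nat and \<gamma> \<alpha> :: real
    and M :: "'a measure"
    and \<Omega> :: "'a measure set"
    and \<omega> :: "nat \<Rightarrow> 'a measure set"
    and p :: "nat \<Rightarrow> 'a \<Rightarrow> real"
    and \<delta> :: "nat \<Rightarrow> real"
  assumes "s \<ge> 1"
    and "0 < \<gamma>" "\<gamma> < 1"
    and "0 < \<alpha>" "\<alpha> < 1"
    and model: "\<And>P. P \<in> \<Omega> \<Longrightarrow> prob_space P \<and> sets P = sets M"
    and hyps: "\<And>i. i \<in> {1..s} \<Longrightarrow> \<omega> i \<subseteq> \<Omega>"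
    and statistics: "\<And>i. i \<in> {1..s} \<Longrightarrow> p i \<in> borel_measurable M"
    and pvalues: "\<And>i P u. i \<in> {1..s} \<Longrightarrow> P \<in> \<omega> i \<Longrightarrow> 0 < u \<Longrightarrow> u < 1 \<Longrightarrow>
                    measure P {x \<in> space P. p i x \<le> u} \<le> u"
    and mono: "mono_on {1..s} \<delta>"
    and range: "\<And>i. i \<in> {1..s} \<Longrightarrow> 0 \<le> \<delta> i \<and> \<delta> i \<le> 1"
  shows "\<forall>P\<in>\<Omega>. measure P {x \<in> space P.
           fdp (stepdown_rejected s (adjusted_const \<alpha> \<delta> \<gamma> s) (\<lambda>i. p i x))
               (true_hyps s \<omega> P) > \<gamma>} \<le> \<alpha>"
proof
  fix P assume P: "P \<in> \<Omega>"
  then interpret prob_space P using model by blast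
  define I where "I = true_hyps s \<omega> P"
  define c where "c = adjusted_const \<alpha> \<delta> \<gamma> s"
  define D where "D = D_const \<delta> \<gamma> s"
  have I: "I \<subseteq> {1..s}"
    by (auto simp: I_def true_hyps_def)
  then have card_I: "card I \<le> s"
    using card_mono[of "{1..s}" I] by simp
  have S_nonneg: "0 \<le> S_sum \<delta> \<gamma> s t" if "t \<le> s" for t
    using assms that by (intro S_sum_nonneg) auto
  have S_le_D: "S_sum \<delta> \<gamma> s (card I) \<le> D" and D_nonneg: "0 \<le> D"
  proof -
    have S_le: "S_sum \<delta> \<gamma> s t \<le> D" if "t \<in> {1..s}" for t
      using that unfolding D_def D_const_def by (intro Max_ge) auto
    then show D: "0 \<le> D"
      using S_nonneg[of s] \<open>s \<ge> 1\<close> by fastforce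
    \<comment> \<open>The maximum runs over \<open>1..s\<close>, so the case of no true hypotheses
      is separate; its sum is 0.\<close>
    show "S_sum \<delta> \<gamma> s (card I) \<le> D"
    proof (cases "card I = 0")
      case True
      with D show ?thesis by (simp add: S_sum_def)
    next
      case False
      with card_I S_le show ?thesis by auto
    qed
  qed
  have c_eq: "c = (\<lambda>i. \<alpha> / D * \<delta> i)"
    by (auto simp: c_def adjusted_const_def D_def)
  have c_nonneg: "0 \<le> c i" if "i \<in> {1..s}" for i
    using range[OF that] D_nonneg \<open>0 < \<alpha>\<close> by (simp add: c_eq)
  have c_mono: "mono_on {1..s} c"
    using mono D_nonneg \<open>0 < \<alpha>\<close> unfolding c_eq mono_on_def by (auto intro!: mult_left_mono divide_right_mono)
  \<comment> \<open>The assumption covers \<open>0 < u < 1\<close> only. At \<open>u = 0\<close>,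
    which occurs when a constant vanishes, the bound follows by letting \<open>v\<close> decrease to
    \<open>u\<close>; for \<open>u \<ge> 1\<close> it is trivial.\<close>
  have cdf: "prob {x \<in> space P. p i x \<le> u} \<le> u" if i: "i \<in> I" and u: "0 \<le> u" for i u
  proof (cases "u < 1")
    case True
    have i': "i \<in> {1..s}" "P \<in> \<omega> i"
      using i by (auto simp: I_def true_hyps_def)
    have [measurable]: "p i \<in> borel_measurable P"
      using statistics[OF i'(1)] model[OF P] measurable_cong_sets by blast
    show ?thesis
    proof (rule dense_ge_bounded[OF True])
      fix v assume v: "u < v" "v < 1"
      have "prob {x \<in> space P. p i x \<le> u} \<le> prob {x \<in> space P. p i x \<le> v}"
        using v by (intro finite_measure_mono) auto
      also have "\<dots> \<le> v"
        using pvalues[OF i'] v u by simp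
      finally show "prob {x \<in> space P. p i x \<le> u} \<le> v" .
    qed
  qed (simp add: order_trans[OF prob_le_1])
  define E where "E = {x \<in> space P. \<exists>m\<in>{1..N_bound \<gamma> s (card I)}.
      m \<le> card {i \<in> I. p i x \<le> beta c \<gamma> s (card I) m}}"
  have "E \<in> events" and "prob E \<le> S_sum c \<gamma> s (card I)"
  proof -
    have rv: "random_variable borel (p i)" if "i \<in> I" for i
      using statistics[of i] model[OF P] that I measurable_cong_sets by blast
    have fin: "finite I" using I finite_subset by blast
    have beta: "beta c \<gamma> s (card I) 0 = 0"
        "mono_on {0..N_bound \<gamma> s (card I)} (beta c \<gamma> s (card I))"
      using assms card_I c_nonneg c_mono by (auto simp: beta_def intro!: mono_on_beta)
    show "E \<in> events" "prob E \<le> S_sum c \<gamma> s (card I)"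
      unfolding E_def S_sum_def
      by (intro prob_order_statistic_union_le fin rv cdf beta; assumption)+
  qed
  \<comment> \<open>Monotonicity of the measure asks for measurability of the larger set
    \<open>E\<close> only.\<close>
  have "prob {x \<in> space P. \<gamma> < fdp (stepdown_rejected s c (\<lambda>i. p i x)) I} \<le> prob E"
    unfolding E_def using fdp_gt_imp_order_statistic_le[OF \<open>0 < \<gamma>\<close> \<open>\<gamma> < 1\<close> c_mono I]
    by (intro finite_measure_mono \<open>E \<in> events\<close>[unfolded E_def]) blast
  also have "\<dots> \<le> S_sum c \<gamma> s (card I)"
    by fact
  also have "\<dots> = \<alpha> / D * S_sum \<delta> \<gamma> s (card I)"
    unfolding c_eq by (rule S_sum_cmult)
  \<comment> \<open>If \<open>D = 0\<close> the convention \<open>x / 0 = 0\<close> makes the bound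
    0. Otherwise \<open>S_sum \<le> D\<close> applies: \<open>D\<close> dominates the sum for every
    possible number of true hypotheses.\<close>
  also have "\<dots> \<le> \<alpha>"
  proof (cases "D = 0")
    case False
    with S_le_D D_nonneg \<open>0 < \<alpha>\<close> show ?thesis
      by (simp add: divide_le_eq)
  qed (use \<open>0 < \<alpha>\<close> in simp)
  finally show "prob {x \<in> space P. fdp (stepdown_rejected s (adjusted_const \<alpha> \<delta> \<gamma> s) (\<lambda>i. p i x))
      (true_hyps s \<omega> P) > \<gamma>} \<le> \<alpha>"
    unfolding I_def c_def .
qed

end
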